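(* Let $\mathsf{R}$ be an ordered ring, $\mathsf{C}=\mathsf{R}(\mathrm{i})$, and let $\mathcal{A}$ be a $^*$-algebra over $\mathsf{C}$ having sufficiently many positive linear functionals. Then every positive deformation $(\mathcal{A}[[\lambda]],\mu,I)$ of $\mathcal{A}$ has sufficiently many positive linear functionals, as a $^*$-algebra over $\mathsf{C}[[\lambda]]=\mathsf{R}[[\lambda]](\mathrm{i})$.
   Context: An ordered ring is an associative, commutative, unital ring $\mathsf{R}$ with a subset $\mathsf{P}\subset\mathsf{R}$ (the positive elements) such that $\mathsf{R}$ is the disjoint union $-\mathsf{P}\cup\{0\}\cup\mathsf{P}$, $\mathsf{P}\cdot\mathsf{P}\subseteq\mathsf{P}$ and $\mathsf{P}+\mathsf{P}\subseteq\mathsf{P}$. $\mathsf{C}=\mathsf{R}(\mathrm{i})$ with $\mathrm{i}^2=-1$ is the quadratic ring extension, with conjugation $\overline{a+\mathrm{i}b}=a-\mathrm{i}b$ for $a,b\in\mathsf{R}$. For $z\in\mathsf{C}$, $z\ge 0$ means $z\in\mathsf{P}\cup\{0\}$. The ring $\mathsf{R}[[\lambda]]$ is again ordered: $a=\sum_{r=r_0}^\infty\lambda^r a_r$ with $a_{r_0}\ne 0$ is positive iff $a_{r_0}>0$. A $^*$-algebra over $\mathsf{C}$ is an associative $\mathsf{C}$-algebra $\mathcal{A}$ (product $\mu_0:\mathcal{A}\otimes\mathcal{A}\to\mathcal{A}$, not necessarily unital) with an involutive $\mathsf{C}$-antilinear anti-automorphism $I_0: A\mapsto A^*$. An element $H$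 is Hermitian if $H^*=H$. A $\mathsf{C}$-linear functional $\omega:\mathcal{A}\to\mathsf{C}$ is positive if $\omega(A^*A)\ge 0$ for all $A\in\mathcal{A}$. $\mathcal{A}$ has sufficiently many positive linear functionals if for every Hermitian $H\ne 0$ there is a positive linear functional $\omega$ with $\omega(H)\neq 0$. The same definitions apply with $\mathsf{R}[[\lambda]]$, $\mathsf{C}[[\lambda]]$ in place of $\mathsf{R}$, $\mathsf{C}$. A $^*$-algebra deformation $(\mathcal{A}[[\lambda]],\mu,I)$ of $\mathcal{A}$ consists of an associative $\mathsf{C}[[\lambda]]$-bilinear product $\mu=\mu_0+\sum_{r\ge 1}\lambda^r\mu_r$ on $\mathcal{A}[[\lambda]]$ and a $\mathsf{C}[[\lambda]]$-antilinear involutive anti-automorphism $I=I_0+\sum_{r\ge 1}\lambda^r I_r$ of $\mu$. Here the $\mu_r$ ($\mathsf{C}$-bilinear) and $I_r$ ($\mathsf{C}$-antilinear) are maps on $\mathcal{A}$, extended to formal power series, with $\overline{\lambda}=\lambda$. The deformation is called positive if for every positive $\mathsf{C}$-linear functional $\omega_0:\mathcal{A}\to\mathsf{C}$ there exist $\mathsf{C}$-linear maps $\omega_r:\mathcal{A}\to\mathsf{C}$, $r\ge 1$, such that the $\mathsf{C}[[\lambda]]$-linear functional $\omega=\sum_{r=0}^\infty\lambda^r\omega_r:\mathcal{A}[[\lambda]]\to\mathsf{C}[[\lambda]]$ is positive for $(\mathcal{A}[[\lambda]],\mu,I)$, i.e. $\omega(\mu(I(A)\otimes A))\ge 0$ for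 all $A\in\mathcal{A}[[\lambda]]$. *)

theory Defs
  imports "HOL-Computational_Algebra.Formal_Power_Series"
begin

unbundle fps_syntax

section \<open>The quadratic extension of an ordered ring\<close>

text \<open>
  An ordered ring with set \<open>P\<close> of positive elements is a type of class
  \<open>linordered_idom\<close>, with \<open>P = {x. 0 < x}\<close>.
  For a commutative ring \<open>R\<close>, the type \<open>R cx\<close> is the quadratic extension \<open>R(i)\<close>;
  the pair \<open>Cx a b\<close> stands for \<open>a + i b\<close>.
\<close>

datatype 'r cx = Cx (cx_re: 'r) (cx_im: 'r)

instantiation cx :: (comm_ring_1) comm_ring_1
begin

definition "0 = Cx 0 0"
definition "1 = Cx 1 0"
definition "z + w = Cx (cx_re z + cx_re w) (cx_im z + cx_im w)"
definition "z - w = Cx (cx_re z - cx_re w) (cx_im z - cx_im w)"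
definition "- z = Cx (- cx_re z) (- cx_im z)"
definition "z * w = Cx (cx_re z * cx_re w - cx_im z * cx_im w)
                       (cx_re z * cx_im w + cx_im z * cx_re w)"

instance
  by standard
    (auto simp: zero_cx_def one_cx_def plus_cx_def minus_cx_def uminus_cx_def times_cx_def
      algebra_simps)

end

lemma cx_sel [simp]:
  "cx_re 0 = 0" "cx_im 0 = 0" "cx_re 1 = 1" "cx_im 1 = 0"
  "cx_re (z + w) = cx_re z + cx_re w" "cx_im (z + w) = cx_im z + cx_im w"
  "cx_re (z - w) = cx_re z - cx_re w" "cx_im (z - w) = cx_im z - cx_im w"
  "cx_re (- z) = - cx_re z" "cx_im (- z) = - cx_im z"
  "cx_re (z * w) = cx_re z * cx_re w - cx_im z * cx_im w"
  "cx_im (z * w) = cx_re z * cx_im w + cx_im z * cx_re w"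
  by (simp_all add: zero_cx_def one_cx_def plus_cx_def minus_cx_def uminus_cx_def times_cx_def)

lemma cx_sel_sum [simp]:
  "cx_re (sum f S) = (\<Sum>x\<in>S. cx_re (f x))" "cx_im (sum f S) = (\<Sum>x\<in>S. cx_im (f x))"
  by (induction S rule: infinite_finite_induct) auto

lemma cx_i_squared: "Cx 0 1 * Cx 0 1 = (- 1 :: 'r::comm_ring_1 cx)"
  by (simp add: cx.expand)

definition cx_cnj :: "'r::comm_ring_1 cx \<Rightarrow> 'r cx" where
  "cx_cnj z = Cx (cx_re z) (- cx_im z)"

definition cx_nonneg :: "'r::linordered_idom cx \<Rightarrow> bool" where
  "cx_nonneg z \<longleftrightarrow> cx_im z = 0 \<and> 0 \<le> cx_re z"


section \<open>The ordering of formal power series\<close>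

text \<open>A nonzero series is positive iff its lowest nonvanishing coefficient is positive.\<close>

instantiation fps :: (linordered_idom) ord
begin

definition less_eq_fps :: "'a fps \<Rightarrow> 'a fps \<Rightarrow> bool" where
  "f \<le> g \<longleftrightarrow> f = g \<or> 0 < (g - f) $ subdegree (g - f)"

definition less_fps :: "'a fps \<Rightarrow> 'a fps \<Rightarrow> bool" where
  "f < g \<longleftrightarrow> 0 < (g - f) $ subdegree (g - f)"

instance ..

end

lemma fps_pos_add:
  fixes f g :: "'a::linordered_idom fps"
  assumes "0 < f $ subdegree f" "0 < g $ subdegree g"
  shows "0 < (f + g) $ subdegree (f + g)"
proof -
  have nn: "0 \<le> h $ n" if "0 < h $ subdegree h" "n \<le> subdegree h" for h :: "'a fps" and n
    using that by (cases "n = subdegree h") (auto simp: nth_less_subdegree_zero)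
  define m where "m = min (subdegree f) (subdegree g)"
  have pos: "0 < (f + g) $ m"
  proof (cases "subdegree f \<le> subdegree g")
    case True
    then show ?thesis
      using assms nn[OF assms(2), of m] by (simp add: m_def min_def add_pos_nonneg)
  next
    case False
    then show ?thesis
      using assms nn[OF assms(1), of m] by (simp add: m_def min_def add_nonneg_pos)
  qed
  have "subdegree (f + g) = m"
  proof (rule subdegreeI)
    show "(f + g) $ m \<noteq> 0" using pos by simp
    show "(f + g) $ i = 0" if "i < m" for i
      using that by (simp add: m_def nth_less_subdegree_zero)
  qed
  then show ?thesis using pos by simp
qed

lemma fps_pos_mult:
  fixes f g :: "'a::linordered_idom fps"
  assumes "0 < f $ subdegree f" "0 < g $ subdegree g"
  shows "0 < (f * g) $ subdegree (f * g)"
proof -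
  have "f \<noteq> 0" "g \<noteq> 0" using assms by auto
  then show ?thesis using assms by simp
qed

instance fps :: (linordered_idom) linorder
proof
  fix f g h :: "'a fps"
  have neg: "(f - g) $ subdegree (f - g) = - ((g - f) $ subdegree (g - f))"
    using subdegree_uminus[of "f - g"] by (metis fps_neg_nth minus_diff_eq)
  show "f \<le> g \<or> g \<le> f"
  proof (cases "f - g = 0")
    case False
    then have "(f - g) $ subdegree (f - g) \<noteq> 0" by (rule nth_subdegree_nonzero)
    then show ?thesis using neg unfolding less_eq_fps_def by linarith
  qed (simp add: less_eq_fps_def)
  show "f < g \<longleftrightarrow> f \<le> g \<and> \<not> g \<le> f"
    using neg by (auto simp: less_eq_fps_def less_fps_def)
  show "f \<le> f"
    by (simp add: less_eq_fps_def)
  show "f \<le> h" if "f \<le> g" "g \<le> h"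
    using that fps_pos_add[of "g - f" "h - g"] by (auto simp: less_eq_fps_def)
  show "f = g" if "f \<le> g" "g \<le> f"
    using that neg by (auto simp: less_eq_fps_def)
qed

instantiation fps :: (linordered_idom) linordered_idom
begin

definition abs_fps :: "'a fps \<Rightarrow> 'a fps" where
  "\<bar>f :: 'a fps\<bar> = (if f < 0 then - f else f)"

definition sgn_fps :: "'a fps \<Rightarrow> 'a fps" where
  "sgn (f :: 'a fps) = (if f = 0 then 0 else if 0 < f then 1 else - 1)"

instance
proof
  fix f g h :: "'a fps"
  show "h + f \<le> h + g" if "f \<le> g"
    using that by (simp add: less_eq_fps_def)
  show "h * f < h * g" if "f < g" "0 < h"
  proof -
    have "0 < (h * (g - f)) $ subdegree (h * (g - f))"
      using that by (intro fps_pos_mult) (simp_all add: less_fps_def)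
    then show ?thesis by (simp add: less_fps_def right_diff_distrib)
  qed
qed (simp_all add: abs_fps_def sgn_fps_def)

end


section \<open>*-algebras and positive functionals\<close>

text \<open>The underlying additive group of an algebra is the whole type \<open>'a\<close>.\<close>

definition bilinear_on ::
  "('k::comm_ring_1 \<Rightarrow> 'a::ab_group_add \<Rightarrow> 'a) \<Rightarrow> ('a \<Rightarrow> 'a \<Rightarrow> 'a) \<Rightarrow> bool" where
  "bilinear_on scale m \<longleftrightarrow>
     (\<forall>x. module_hom scale scale (\<lambda>y. m x y)) \<and> (\<forall>y. module_hom scale scale (\<lambda>x. m x y))"

definition antilinear ::
  "('r::comm_ring_1 cx \<Rightarrow> 'a::ab_group_add \<Rightarrow> 'a) \<Rightarrow> ('a \<Rightarrow> 'a) \<Rightarrow> bool" where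
  "antilinear scale s \<longleftrightarrow>
     (\<forall>x y. s (x + y) = s x + s y) \<and> (\<forall>c x. s (scale c x) = scale (cx_cnj c) (s x))"

locale star_algebra = module scale
  for scale :: "'r::linordered_idom cx \<Rightarrow> 'a::ab_group_add \<Rightarrow> 'a" +
  fixes mul :: "'a \<Rightarrow> 'a \<Rightarrow> 'a"
    and star :: "'a \<Rightarrow> 'a"
  assumes mult_bilinear: "bilinear_on scale mul"
    and mult_assoc: "mul (mul x y) z = mul x (mul y z)"
    and star_antilinear: "antilinear scale star"
    and star_star: "star (star x) = x"
    and star_mult: "star (mul x y) = mul (star y) (star x)"

definition positive_functional ::
  "('r::linordered_idom cx \<Rightarrow> 'a::ab_group_add \<Rightarrow> 'a) \<Rightarrow> ('a \<Rightarrow> 'a \<Rightarrow> 'a) \<Rightarrow> ('a \<Rightarrow> 'a)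
    \<Rightarrow> ('a \<Rightarrow> 'r cx) \<Rightarrow> bool" where
  "positive_functional scale mul star \<omega> \<longleftrightarrow>
     module_hom scale (*) \<omega> \<and> (\<forall>x. cx_nonneg (\<omega> (mul (star x) x)))"

definition sufficiently_many_positive_functionals ::
  "('r::linordered_idom cx \<Rightarrow> 'a::ab_group_add \<Rightarrow> 'a) \<Rightarrow> ('a \<Rightarrow> 'a \<Rightarrow> 'a) \<Rightarrow> ('a \<Rightarrow> 'a)
    \<Rightarrow> bool" where
  "sufficiently_many_positive_functionals scale mul star \<longleftrightarrow>
     (\<forall>h. star h = h \<and> h \<noteq> 0 \<longrightarrow> (\<exists>\<omega>. positive_functional scale mul star \<omega> \<and> \<omega> h \<noteq> 0))"


section \<open>Formal series over a *-algebra\<close>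

text \<open>
  The additive group \<open>A[[\<lambda>]]\<close> is \<open>'a fps\<close>, and its scalars \<open>C[[\<lambda>]] = R[[\<lambda>]](i)\<close> are
  \<open>'r fps cx\<close>, so that the notions above apply with \<open>'r fps\<close> in place of \<open>'r\<close>.
  The following maps identify \<open>R[[\<lambda>]](i)\<close> with \<open>R(i)[[\<lambda>]]\<close>.
\<close>

definition series_of_cx :: "'r::comm_ring_1 fps cx \<Rightarrow> 'r cx fps" where
  "series_of_cx c = Abs_fps (\<lambda>n. Cx (cx_re c $ n) (cx_im c $ n))"

definition cx_of_series :: "'r::comm_ring_1 cx fps \<Rightarrow> 'r fps cx" where
  "cx_of_series f = Cx (Abs_fps (\<lambda>n. cx_re (f $ n))) (Abs_fps (\<lambda>n. cx_im (f $ n)))"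

lemma cx_of_series_of_cx [simp]: "cx_of_series (series_of_cx c) = c"
  by (simp add: cx_of_series_def series_of_cx_def cx.expand fps_eq_iff)

lemma series_of_cx_of_series [simp]: "series_of_cx (cx_of_series f) = f"
  by (simp add: cx_of_series_def series_of_cx_def fps_eq_iff)

lemma series_of_cx_add: "series_of_cx (c + d) = series_of_cx c + series_of_cx d"
  by (simp add: series_of_cx_def fps_eq_iff cx.expand)

lemma series_of_cx_mult: "series_of_cx (c * d) = series_of_cx c * series_of_cx d"
  by (simp add: series_of_cx_def fps_eq_iff cx.expand fps_mult_nth sum.distrib sum_subtractf)

lemma series_of_cx_one: "series_of_cx 1 = 1"
  by (simp add: series_of_cx_def fps_eq_iff cx.expand)

definition fps_scale ::
  "('r::comm_ring_1 cx \<Rightarrow> 'a::ab_group_add \<Rightarrow> 'a) \<Rightarrow> 'r fps cx \<Rightarrow> 'a fps \<Rightarrow> 'a fps" where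
  "fps_scale scale c f = Abs_fps (\<lambda>n. \<Sum>k\<le>n. scale (series_of_cx c $ k) (f $ (n - k)))"

text \<open>
  A family \<open>\<phi> r\<close> (resp. \<open>m r\<close>) of additive (resp. biadditive) maps is extended
  \<open>\<lambda>\<close>-linearly to formal series, as \<open>\<Sum>r. \<lambda>^r (\<phi> r)\<close> (resp. \<open>\<Sum>r. \<lambda>^r (m r)\<close>).
\<close>

definition fps_extend :: "(nat \<Rightarrow> 'a \<Rightarrow> 'b) \<Rightarrow> 'a fps \<Rightarrow> 'b::comm_monoid_add fps" where
  "fps_extend \<phi> f = Abs_fps (\<lambda>n. \<Sum>r\<le>n. \<phi> r (f $ (n - r)))"

definition fps_extend2 ::
  "(nat \<Rightarrow> 'a \<Rightarrow> 'a \<Rightarrow> 'a) \<Rightarrow> 'a fps \<Rightarrow> 'a fps \<Rightarrow> 'a::comm_monoid_add fps" where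
  "fps_extend2 m f g =
     Abs_fps (\<lambda>n. \<Sum>r\<le>n. \<Sum>i\<le>n - r. m r (f $ i) (g $ (n - r - i)))"

definition star_deformation ::
  "('r::linordered_idom cx \<Rightarrow> 'a::ab_group_add \<Rightarrow> 'a) \<Rightarrow> ('a \<Rightarrow> 'a \<Rightarrow> 'a) \<Rightarrow> ('a \<Rightarrow> 'a)
    \<Rightarrow> (nat \<Rightarrow> 'a \<Rightarrow> 'a \<Rightarrow> 'a) \<Rightarrow> (nat \<Rightarrow> 'a \<Rightarrow> 'a) \<Rightarrow> bool" where
  "star_deformation scale mul star \<mu> I \<longleftrightarrow>
     \<mu> 0 = mul \<and> I 0 = star \<and>
     (\<forall>r. bilinear_on scale (\<mu> r)) \<and> (\<forall>r. antilinear scale (I r)) \<and>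
     star_algebra (fps_scale scale) (fps_extend2 \<mu>) (fps_extend I)"

definition positive_deformation ::
  "('r::linordered_idom cx \<Rightarrow> 'a::ab_group_add \<Rightarrow> 'a) \<Rightarrow> ('a \<Rightarrow> 'a \<Rightarrow> 'a) \<Rightarrow> ('a \<Rightarrow> 'a)
    \<Rightarrow> (nat \<Rightarrow> 'a \<Rightarrow> 'a \<Rightarrow> 'a) \<Rightarrow> (nat \<Rightarrow> 'a \<Rightarrow> 'a) \<Rightarrow> bool" where
  "positive_deformation scale mul star \<mu> I \<longleftrightarrow>
     star_deformation scale mul star \<mu> I \<and>
     (\<forall>\<omega>\<^sub>0. positive_functional scale mul star \<omega>\<^sub>0 \<longrightarrow>
       (\<exists>\<omega>. \<omega> 0 = \<omega>\<^sub>0 \<and> (\<forall>r\<ge>1. module_hom scale (*) (\<omega> r)) \<and>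
         positive_functional (fps_scale scale) (fps_extend2 \<mu>) (fps_extend I)
           (\<lambda>f. cx_of_series (fps_extend \<omega> f))))"

end

theory Submission
  imports Defs
begin

text \<open>
  The extension \<open>\<Sum>r. \<lambda>^r (\<phi> r)\<close> of a family of additive maps acts on the lowest
  nonvanishing coefficient of a series through \<open>\<phi> 0\<close> alone
  (\<open>fps_extend_lowest_coefficient\<close>). Applied to \<open>I\<close>, this shows that the lowest coefficient
  \<open>h\<^sub>0 \<noteq> 0\<close> of a Hermitian series \<open>h\<close> is Hermitian in the undeformed algebra, so some positive
  functional \<open>\<omega>\<^sub>0\<close> does not vanish on \<open>h\<^sub>0\<close>. The positivity of the deformation yields a positive
  functional \<open>\<omega>\<close> of the deformed algebra with zeroth order \<open>\<omega>\<^sub>0\<close>; applying the same principle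
  to \<open>\<omega>\<close> shows that the corresponding coefficient of \<open>\<omega> h\<close> is \<open>\<omega>\<^sub>0 h\<^sub>0 \<noteq> 0\<close>.
\<close>

text \<open>
  In this coefficient every \<open>\<phi> r\<close> with \<open>r > 0\<close> is applied to a coefficient of \<open>f\<close> of order
  below \<open>subdegree f\<close>, which is \<open>0\<close>.
\<close>
lemma fps_extend_lowest_coefficient:
  assumes "\<And>r. \<phi> r 0 = 0"
  shows "fps_extend \<phi> f $ subdegree f = \<phi> 0 (f $ subdegree f)"
proof -
  let ?n = "subdegree f"
  have "(\<Sum>r\<le>?n. \<phi> r (f $ (?n - r))) = (\<Sum>r\<in>{0}. \<phi> r (f $ (?n - r)))"
    by (rule sum.mono_neutral_right) (auto simp: assms nth_less_subdegree_zero)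
  then show ?thesis
    by (simp add: fps_extend_def)
qed

lemma antilinear_zero: "antilinear scale s \<Longrightarrow> s 0 = 0"
  unfolding antilinear_def by (metis add_cancel_left_left)

theorem proposition4p2:
  fixes scale :: "'r::linordered_idom cx \<Rightarrow> 'a::ab_group_add \<Rightarrow> 'a"
    and mul :: "'a \<Rightarrow> 'a \<Rightarrow> 'a"
    and star :: "'a \<Rightarrow> 'a"
    and \<mu> :: "nat \<Rightarrow> 'a \<Rightarrow> 'a \<Rightarrow> 'a"
    and I :: "nat \<Rightarrow> 'a \<Rightarrow> 'a"
  assumes "star_algebra scale mul star"
    and "sufficiently_many_positive_functionals scale mul star"
    and "positive_deformation scale mul star \<mu> I"
  shows "sufficiently_many_positive_functionals
           (fps_scale scale) (fps_extend2 \<mu>) (fps_extend I)"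
  unfolding sufficiently_many_positive_functionals_def
proof (intro allI impI, elim conjE)
  fix h :: "'a fps"
  assume herm: "fps_extend I h = h" and "h \<noteq> 0"
  let ?n = "subdegree h"
  have I: "I 0 = star" "\<And>r. antilinear scale (I r)"
    using assms(3) by (auto simp: positive_deformation_def star_deformation_def)
  have "star (h $ ?n) = h $ ?n"
    using fps_extend_lowest_coefficient[of I h] herm I antilinear_zero by metis
  moreover have "h $ ?n \<noteq> 0"
    using \<open>h \<noteq> 0\<close> by simp
  ultimately obtain \<omega>\<^sub>0 where \<omega>\<^sub>0: "positive_functional scale mul star \<omega>\<^sub>0" "\<omega>\<^sub>0 (h $ ?n) \<noteq> 0"
    using assms(2) unfolding sufficiently_many_positive_functionals_def by blast
  then obtain \<omega> where \<omega>: "\<omega> 0 = \<omega>\<^sub>0" "\<And>r. r \<ge> 1 \<Longrightarrow> module_hom scale (*) (\<omega> r)"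
      "positive_functional (fps_scale scale) (fps_extend2 \<mu>) (fps_extend I)
         (\<lambda>f. cx_of_series (fps_extend \<omega> f))"
    using assms(3) unfolding positive_deformation_def by blast
  have "module_hom scale (*) (\<omega> r)" for r
    using \<omega>(1,2) \<omega>\<^sub>0(1) by (cases r) (auto simp: positive_functional_def)
  then have "fps_extend \<omega> h $ ?n = \<omega>\<^sub>0 (h $ ?n)"
    using fps_extend_lowest_coefficient[of \<omega> h] module_hom.zero \<omega>(1) by metis
  with \<omega>\<^sub>0(2) have "fps_extend \<omega> h \<noteq> 0"
    by auto
  moreover have "series_of_cx 0 = (0 :: 'r cx fps)"
    by (simp add: series_of_cx_def fps_eq_iff zero_cx_def)
  ultimately have "cx_of_series (fps_extend \<omega> h) \<noteq> 0"
    by (metis series_of_cx_of_series)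
  with \<omega>(3) show "\<exists>\<omega>. positive_functional (fps_scale scale) (fps_extend2 \<mu>) (fps_extend I) \<omega>
      \<and> \<omega> h \<noteq> 0"
    by blast
qed

end
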